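(* Consider the entropy stable collocated SBP–SAT semidiscretization of the Eulerian model on a cubic element with a no-slip solid wall on the face $x_i=0$. Let $g(t)$ be the prescribed wall heat entropy flux. The penalty terms for the viscous flux in the conserved variables, $\mathbf g^{(b,V),q}_{x_i}$, and in the gradient of the entropy variables, $\mathbf g^{(b,V),\Theta}_{x_i}$, as defined in the context, are (1) entropy conservative if the wall is adiabatic, i.e. $g(t)=0$; (2) entropy stable in the presence of a heat flux $g(t)\neq0$, where $g(t)$ is a given $L^2$ function. Here "entropy conservative" means that the contribution $C^{(V)}$ (defined in the context) of these two penalty terms to the right-hand side of the semidiscrete entropy balance is zero. "Entropy stable" means that this contribution, which equals $\mathbf 1^\top\widehat{\mathcal P}_{x_j,x_k}\,g(t)$, is bounded by data.
   Context: Model. The three-dimensional Eulerian model for viscous, heat conducting compressible flow is $\partial_t q+\partial_{x_l}f^{(I)}_l=\partial_{x_l}(\nu\,\partial_{x_l}q)$ (sum over $l=1,2,3$), with $q=(\rho,\rho\mathcal U_1,\rho\mathcal U_2,\rho\mathcal U_3,\rho\mathcal E)^\top$. Here $f^{(I)}_l$ is the usual compressible Euler flux in direction $x_l$, $p=\rho R\mathcal T$, $\mathcal E=c_v\mathcal T+\frac12\|\mathcal U\|^2$, $R=c_p-c_v$, and $\nu=\alpha\mu/\rho$ with dynamic viscosity $\mu>0$ and $\alpha\in[1,\frac43]$. Density $\rho$ and temperature $\mathcal T$ are positive. The primitive variables are $v=(\rho,\mathcal U_1,\mathcal U_2,\mathcal U_3,\mathcal T)^\top$. The entropy is $\mathcal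 S=-\rho s$, where $s=c_v\ln\mathcal T-R\ln\rho$ (up to an additive constant) is the thermodynamic entropy. The entropy variables are $w=(d\mathcal S/dq)^\top=\left(c_p-s-\frac{\|\mathcal U\|^2}{2\mathcal T},\frac{\mathcal U_1}{\mathcal T},\frac{\mathcal U_2}{\mathcal T},\frac{\mathcal U_3}{\mathcal T},-\frac1{\mathcal T}\right)^\top$. The Jacobians $\frac{dq}{dw}(v)$ and $\frac{dw}{dv}(v)$ are evaluated at the state $v$, and $\frac{dq}{dw}$ is symmetric positive-definite. Discretization. Nodal values are stored at tensor-product Legendre–Gauss–Lobatto nodes of the element; bold symbols collect values at all nodes. One-dimensional summation-by-parts (SBP) operators $\mathcal D=\mathcal P^{-1}\mathcal Q$, with $\mathcal P$ diagonal positive-definite and $\mathcal Q+\mathcal Q^\top=\mathcal B=\mathrm{diag}(-1,0,\dots,0,1)$, are extended by tensor products, a subscript $x_i$ denoting the operator acting in direction $x_i$. $\mathcal P$ without subscript is the three-dimensional product of the one-dimensional norms. $\mathcal P_{x_j,x_k}$ ($\{j,k\}=\{1,2,3\}\setminus\{i\}$) is the product of the norms in the two directions tangential to the wall. $\mathcal B_{x_i}=\mathcal B^+_{x_i}-\mathcal B^-_{x_i}$, where $\mathcal B^-_{x_i}$ selects the nodes on the face $x_i=0$ (the wall) and $\mathcal B^+_{x_i}$ those on the opposite face. Hats denote scalar versions of the operators. The semidiscretization on the element is $$\frac{\partial\mathbf q}{\partial t}+\mathcal P^{-1}_{x_i}\Delta_{x_i}\bar{\mathbf f}^{(I)}_{i,sc}-\mathcal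 D_{x_i}\left[\nu\tfrac{dq}{dw}\right]\mathbf\Theta_{x_i}=\mathcal P^{-1}_{x_i}\mathbf g^{(b),q}_{x_i},\qquad \mathbf\Theta_{x_i}-\mathcal D_{x_i}\mathbf w=\mathcal P^{-1}_{x_i}\mathbf g^{(b),\Theta}_{x_i}$$ (directions summed in the first equation). $\mathcal P^{-1}_{x_i}\Delta_{x_i}\bar{\mathbf f}^{(I)}_{i,sc}$ is the entropy conservative discretization of the inviscid flux derivative, with $\Delta_{x_i}$ the difference operator between adjacent flux points and $\bar{\mathbf f}^{(I)}_{i,sc}$ built from an entropy conservative two-point flux. $\mathbf\Theta_{x_i}$ is the discrete gradient of the entropy variables, and $[\nu\frac{dq}{dw}]$ is block-diagonal with nodal blocks $\nu\frac{dq}{dw}(v)$. The terms $\mathbf g^{(b),q}_{x_i}$ and $\mathbf g^{(b),\Theta}_{x_i}$ are the boundary (SAT) penalties. $\mathbf g^{(b),q}_{x_i}$ is a sum of several terms (inviscid, viscous, interior penalty, source), of which only the viscous term $\mathbf g^{(b,V),q}_{x_i}$ is considered here; the interior penalty term is set to zero. Also $\mathbf g^{(b),\Theta}_{x_i}=\mathbf g^{(b,V),\Theta}_{x_i}$. Viscous wall penalty terms: $$\mathbf g^{(b,V),q}_{x_i}=\tfrac12\mathcal B^-_{x_i}\left(\left[\nu\tfrac{dq}{dw}\right]\mathbf\Theta_{x_i}-\mathbf f^{(b,V)}_i\right),\qquad \mathbf g^{(b,V),\Theta}_{x_i}=\tfrac12\mathcal B^-_{x_i}\left(\mathbf w-\mathbf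 w^{(b,V)}\right).$$ At each wall node, $w^{(b,V)}$ is the entropy-variable vector of the manufactured primitive state $$v^{(b,V)}=\left(\rho,\,-\mathcal U_1+2\mathcal U_1^{\text{wall}},\,-\mathcal U_2+2\mathcal U_2^{\text{wall}},\,-\mathcal U_3+2\mathcal U_3^{\text{wall}},\,\mathcal T\right)^\top,$$ with $\mathcal U^{\text{wall}}$ the prescribed wall velocity ($\mathcal U^{\text{wall}}_i=0$), and $$f^{(b,V)}_i=\nu\,\tfrac{dq}{dw}\left(v^{(b,V)}\right)\widetilde\Theta_{x_i},\qquad \widetilde\Theta_{x_i}=\tfrac{dw}{dv}\left(v^{(b,V)}\right)\mathrm{diag}(-1,1,1,1,-1)\,\Pi,$$ where $\Pi$ is the gradient of the primitive variables, i.e. $\Theta_{x_i}=\frac{dw}{dv}(v)\,\Pi$. Entropy contribution. The left-hand side of the semidiscrete entropy balance is $\frac{d}{dt}\mathbf 1^\top\widehat{\mathcal P}\boldsymbol{\mathcal S}+\mathbf{DT}$, with $\mathbf{DT}=\|[\nu\frac{dq}{dw}]^{1/2}\mathbf\Theta_{x_i}\|_{\mathcal P}^2\ge0$. The contribution of the two viscous wall penalty terms to its right-hand side is $$C^{(V)}=\mathbf w^\top\mathcal P_{x_j,x_k}\mathbf g^{(b,V),q}_{x_i}+\left(\left[\nu\tfrac{dq}{dw}\right]\mathbf\Theta_{x_i}\right)^\top\mathcal P_{x_j,x_k}\mathbf g^{(b,V),\Theta}_{x_i}.$$ With the right-hand side taken to be this contribution, the balance reads $\frac{d}{dt}\mathbf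 1^\top\widehat{\mathcal P}\boldsymbol{\mathcal S}+\mathbf{DT}=\mathbf 1^\top\widehat{\mathcal P}_{x_j,x_k}\,g(t)$. Heat flux data. $g(t)$, evaluated at the wall nodes, is the datum imposed for the wall heat entropy flux. In the semidiscrete setting it is identified with the viscous boundary flux at the wall by $$\mathbf 1^\top\widehat{\mathcal P}_{x_j,x_k}\widehat{\mathcal B}^-_{x_i}\mathbf W\left[\nu\tfrac{dq}{dw}\right]\mathbf\Theta_{x_i}=\mathbf 1^\top\widehat{\mathcal P}_{x_j,x_k}\,g(t),\qquad \mathbf W=\mathrm{diag}(\mathbf w),$$ where the left side denotes $\mathbf w^\top\mathcal P_{x_j,x_k}\mathcal B^-_{x_i}[\nu\frac{dq}{dw}]\mathbf\Theta_{x_i}$. An adiabatic wall is the case $g(t)=0$. *)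

theory Defs
  imports "HOL-Analysis.Analysis" "HOL-Computational_Algebra.Polynomial"
begin

text \<open>
  A vector of R^5 is split as (scalar, 3-vector, scalar).  Its inner product is the
  Euclidean one, and Jacobian matrices appear as the linear maps they represent.
\<close>

type_synonym state = "real \<times> (real ^ 3) \<times> real"

record fluid =
  c_p :: real
  c_v :: real
  s_0 :: real \<comment> \<open>additive constant of the thermodynamic entropy\<close>
  alpha :: real
  mu :: "real \<Rightarrow> real" \<comment> \<open>dynamic viscosity as a function of temperature\<close>

definition valid_fluid :: "fluid \<Rightarrow> bool" where
  "valid_fluid G \<longleftrightarrow> 0 < c_v G \<and> c_v G < c_p G \<and> 1 \<le> alpha G \<and> alpha G \<le> 4 / 3 \<and>
     (\<forall>T > 0. mu G T > 0)"

definition gas_R :: "fluid \<Rightarrow> real" where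
  "gas_R G = c_p G - c_v G"

definition admissible :: "state set" where
  "admissible = {(\<rho>, U, T). \<rho> > 0 \<and> T > 0}"

definition nu :: "fluid \<Rightarrow> state \<Rightarrow> real" where
  "nu G = (\<lambda>(\<rho>, U, T). alpha G * mu G T / \<rho>)"

definition total_energy :: "fluid \<Rightarrow> state \<Rightarrow> real" where
  "total_energy G = (\<lambda>(\<rho>, U, T). c_v G * T + (norm U)\<^sup>2 / 2)"

definition conservative_vars :: "fluid \<Rightarrow> state \<Rightarrow> state" where
  "conservative_vars G v = (case v of (\<rho>, U, T) \<Rightarrow> (\<rho>, \<rho> *\<^sub>R U, \<rho> * total_energy G v))"

definition thermo_entropy :: "fluid \<Rightarrow> state \<Rightarrow> real" where
  "thermo_entropy G = (\<lambda>(\<rho>, U, T). c_v G * ln T - gas_R G * ln \<rho> + s_0 G)"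

definition entropy :: "fluid \<Rightarrow> state \<Rightarrow> real" where
  "entropy G v = - fst v * thermo_entropy G v"

definition entropy_vars :: "fluid \<Rightarrow> state \<Rightarrow> state" where
  "entropy_vars G v = (case v of (\<rho>, U, T) \<Rightarrow>
     (c_p G - thermo_entropy G v - (norm U)\<^sup>2 / (2 * T), (1 / T) *\<^sub>R U, - 1 / T))"

definition dq_dw :: "fluid \<Rightarrow> state \<Rightarrow> state \<Rightarrow> state" where
  "dq_dw G v = frechet_derivative
     (\<lambda>w. conservative_vars G (inv_into admissible (entropy_vars G) w)) (at (entropy_vars G v))"

definition dw_dv :: "fluid \<Rightarrow> state \<Rightarrow> state \<Rightarrow> state" where
  "dw_dv G v = frechet_derivative (entropy_vars G) (at v)"

definition euler_flux :: "fluid \<Rightarrow> 3 \<Rightarrow> state \<Rightarrow> state" where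
  "euler_flux G l v = (case v of (\<rho>, U, T) \<Rightarrow>
     let p = \<rho> * gas_R G * T in
     (\<rho> * U $ l, (\<rho> * U $ l) *\<^sub>R U + p *\<^sub>R axis l 1, (\<rho> * total_energy G v + p) * U $ l))"

text \<open>Entropy flux potential: \<open>w\<close> paired with the flux, minus the entropy flux \<open>entropy * U\<close>.\<close>

definition flux_potential :: "fluid \<Rightarrow> 3 \<Rightarrow> state \<Rightarrow> real" where
  "flux_potential G l v =
     entropy_vars G v \<bullet> euler_flux G l v - entropy G v * (fst (snd v)) $ l"

text \<open>Two-point fluxes take primitive states as arguments.\<close>

definition entropy_conservative_flux ::
  "fluid \<Rightarrow> (3 \<Rightarrow> state \<Rightarrow> state \<Rightarrow> state) \<Rightarrow> bool" where
  "entropy_conservative_flux G f \<longleftrightarrow>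
     (\<forall>l. \<forall>v \<in> admissible. f l v v = euler_flux G l v) \<and>
     (\<forall>l. \<forall>v \<in> admissible. \<forall>v' \<in> admissible. f l v v' = f l v' v) \<and>
     (\<forall>l. \<forall>v \<in> admissible. \<forall>v' \<in> admissible.
        (entropy_vars G v - entropy_vars G v') \<bullet> f l v v' =
        flux_potential G l v - flux_potential G l v')"

record sbp =
  edge :: real \<comment> \<open>edge length of the cube\<close>
  npts :: nat \<comment> \<open>number of nodes per direction\<close>
  node1 :: "nat \<Rightarrow> real"
  P1 :: "nat \<Rightarrow> real" \<comment> \<open>diagonal of the one-dimensional norm\<close>
  Q1 :: "nat \<Rightarrow> nat \<Rightarrow> real"

definition D1 :: "sbp \<Rightarrow> nat \<Rightarrow> nat \<Rightarrow> real" where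
  "D1 S j k = Q1 S j k / P1 S j"

definition legendre :: "nat \<Rightarrow> real poly" where
  "legendre N = smult (1 / (2 ^ N * fact N)) ((pderiv ^^ N) ([:-1, 0, 1:] ^ N))"

text \<open>
  Legendre-Gauss-Lobatto points are the zeros of \<open>(1 - t^2) * legendre N'\<close>, mapped here
  from \<open>[-1, 1]\<close> to \<open>[0, edge]\<close>.
\<close>

definition lgl_sbp :: "sbp \<Rightarrow> bool" where
  "lgl_sbp S \<longleftrightarrow> edge S > 0 \<and> npts S \<ge> 2 \<and>
     strict_mono_on {..<npts S} (node1 S) \<and>
     node1 S ` {..<npts S} =
       (\<lambda>t. edge S * (1 + t) / 2) ` {t. (1 - t\<^sup>2) * poly (pderiv (legendre (npts S - 1))) t = 0} \<and>
     (\<forall>j < npts S. P1 S j > 0) \<and>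
     (\<forall>j < npts S. \<forall>k < npts S. Q1 S j k + Q1 S k j =
        (if j = k then (if j = 0 then -1 else if j = npts S - 1 then 1 else 0) else 0)) \<and>
     (\<forall>p :: real poly. degree p \<le> npts S - 1 \<longrightarrow>
        (\<forall>j < npts S. (\<Sum>k<npts S. D1 S j k * poly p (node1 S k)) = poly (pderiv p) (node1 S j)))"

text \<open>A three-dimensional node is its triple of one-dimensional indices.\<close>

type_synonym node = "3 \<Rightarrow> nat"

definition nodes :: "sbp \<Rightarrow> node set" where
  "nodes S = {m. \<forall>l. m l < npts S}"

definition diff_op :: "sbp \<Rightarrow> 3 \<Rightarrow> (node \<Rightarrow> state) \<Rightarrow> node \<Rightarrow> state" where
  "diff_op S l \<phi> m = (\<Sum>k<npts S. D1 S (m l) k *\<^sub>R \<phi> (m(l := k)))"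

definition P_tan :: "sbp \<Rightarrow> 3 \<Rightarrow> node \<Rightarrow> real" where
  "P_tan S i m = (\<Prod>j \<in> UNIV - {i}. P1 S (m j))"

definition B_minus :: "3 \<Rightarrow> (node \<Rightarrow> 'a::zero) \<Rightarrow> node \<Rightarrow> 'a" where
  "B_minus i \<phi> m = (if m i = 0 then \<phi> m else 0)"

definition wall_nodes :: "sbp \<Rightarrow> 3 \<Rightarrow> node set" where
  "wall_nodes S i = {m \<in> nodes S. m i = 0}"

text \<open>
  Values at the flux points \<open>0, ..., npts\<close> of a grid line, from its nodal states \<open>u\<close>:
  the physical flux at the two end points, and the high-order combination
  of the two-point flux in the interior.
\<close>

definition flux_point ::
  "fluid \<Rightarrow> sbp \<Rightarrow> (3 \<Rightarrow> state \<Rightarrow> state \<Rightarrow> state) \<Rightarrow> 3 \<Rightarrow> (nat \<Rightarrow> state) \<Rightarrow> nat \<Rightarrow> state" where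
  "flux_point G S f l u j =
     (if j = 0 then euler_flux G l (u 0)
      else if j = npts S then euler_flux G l (u (npts S - 1))
      else (\<Sum>k \<in> {j..<npts S}. \<Sum>r<j. (2 * Q1 S r k) *\<^sub>R f l (u r) (u k)))"

definition inviscid_div ::
  "fluid \<Rightarrow> sbp \<Rightarrow> (3 \<Rightarrow> state \<Rightarrow> state \<Rightarrow> state) \<Rightarrow> 3 \<Rightarrow> (node \<Rightarrow> state) \<Rightarrow> node \<Rightarrow> state" where
  "inviscid_div G S f l v m =
     (1 / P1 S (m l)) *\<^sub>R
       (flux_point G S f l (\<lambda>k. v (m(l := k))) (Suc (m l)) -
        flux_point G S f l (\<lambda>k. v (m(l := k))) (m l))"

definition viscous_flux :: "fluid \<Rightarrow> state \<Rightarrow> state \<Rightarrow> state" where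
  "viscous_flux G v \<theta> = nu G v *\<^sub>R dq_dw G v \<theta>"

definition wall_state :: "real ^ 3 \<Rightarrow> state \<Rightarrow> state" where
  "wall_state Uwall = (\<lambda>(\<rho>, U, T). (\<rho>, - U + 2 *\<^sub>R Uwall, T))"

text \<open>
  \<open>primitive_gradient G v \<theta>\<close> is the vector written as Pi: the solution of
  \<open>dw_dv G v Pi = \<theta>\<close>, the Jacobian being invertible on admissible states.
\<close>

definition primitive_gradient :: "fluid \<Rightarrow> state \<Rightarrow> state \<Rightarrow> state" where
  "primitive_gradient G v \<theta> = inv (dw_dv G v) \<theta>"

definition mirror_gradient :: "state \<Rightarrow> state" where
  "mirror_gradient = (\<lambda>(a, b, c). (- a, b, - c))"

text \<open>
  The viscosity coefficient is that of the nodal state; it agrees with the coefficient of the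
  manufactured state, which has the same density and temperature.
\<close>

definition wall_flux :: "fluid \<Rightarrow> real ^ 3 \<Rightarrow> state \<Rightarrow> state \<Rightarrow> state" where
  "wall_flux G Uwall v \<theta> =
     nu G v *\<^sub>R dq_dw G (wall_state Uwall v)
       (dw_dv G (wall_state Uwall v) (mirror_gradient (primitive_gradient G v \<theta>)))"

definition viscous_penalty_q ::
  "fluid \<Rightarrow> 3 \<Rightarrow> (node \<Rightarrow> real ^ 3) \<Rightarrow> (node \<Rightarrow> state) \<Rightarrow> (node \<Rightarrow> state) \<Rightarrow> node \<Rightarrow> state" where
  "viscous_penalty_q G i Uwall v \<theta> m =
     (1 / 2) *\<^sub>R B_minus i (\<lambda>m. viscous_flux G (v m) (\<theta> m) - wall_flux G (Uwall m) (v m) (\<theta> m)) m"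

definition viscous_penalty_theta ::
  "fluid \<Rightarrow> 3 \<Rightarrow> (node \<Rightarrow> real ^ 3) \<Rightarrow> (node \<Rightarrow> state) \<Rightarrow> node \<Rightarrow> state" where
  "viscous_penalty_theta G i Uwall v m =
     (1 / 2) *\<^sub>R B_minus i
       (\<lambda>m. entropy_vars G (v m) - entropy_vars G (wall_state (Uwall m) (v m))) m"

definition viscous_contribution ::
  "fluid \<Rightarrow> sbp \<Rightarrow> 3 \<Rightarrow> (node \<Rightarrow> real ^ 3) \<Rightarrow> (node \<Rightarrow> state) \<Rightarrow> (node \<Rightarrow> state) \<Rightarrow> real" where
  "viscous_contribution G S i Uwall v \<theta> =
     (\<Sum>m \<in> nodes S. P_tan S i m *
        (entropy_vars G (v m) \<bullet> viscous_penalty_q G i Uwall v \<theta> m)) +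
     (\<Sum>m \<in> nodes S. P_tan S i m *
        (viscous_flux G (v m) (\<theta> m) \<bullet> viscous_penalty_theta G i Uwall v m))"

text \<open>
  Penalties in direction \<open>l\<close> act on the two faces normal to \<open>l\<close>.
  In the wall-normal direction \<open>i\<close>, \<open>gI\<close>, \<open>gM\<close>, \<open>gS\<close> are the inviscid, interior and source
  parts of the penalty on the conserved variables; \<open>gI\<close>, \<open>gS\<close> and the penalties of the
  directions other than \<open>i\<close> are left arbitrary.
\<close>

definition semidiscretization ::
  "fluid \<Rightarrow> sbp \<Rightarrow> (3 \<Rightarrow> state \<Rightarrow> state \<Rightarrow> state) \<Rightarrow> 3 \<Rightarrow> real \<Rightarrow> (real \<Rightarrow> node \<Rightarrow> real ^ 3) \<Rightarrow>
   (real \<Rightarrow> node \<Rightarrow> state) \<Rightarrow> (3 \<Rightarrow> real \<Rightarrow> node \<Rightarrow> state) \<Rightarrow>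
   (3 \<Rightarrow> real \<Rightarrow> node \<Rightarrow> state) \<Rightarrow> (3 \<Rightarrow> real \<Rightarrow> node \<Rightarrow> state) \<Rightarrow>
   (real \<Rightarrow> node \<Rightarrow> state) \<Rightarrow> (real \<Rightarrow> node \<Rightarrow> state) \<Rightarrow> (real \<Rightarrow> node \<Rightarrow> state) \<Rightarrow> bool" where
  "semidiscretization G S f i tf Uwall v \<Theta> gq g\<Theta> gI gM gS \<longleftrightarrow>
     (\<forall>t \<in> {0..tf}. \<forall>m \<in> nodes S.
        v t m \<in> admissible \<and>
        ((\<lambda>t. conservative_vars G (v t m)) has_vector_derivative
          (\<Sum>l \<in> UNIV.
             - inviscid_div G S f l (v t) m
             + diff_op S l (\<lambda>k. viscous_flux G (v t k) (\<Theta> l t k)) m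
             + (1 / P1 S (m l)) *\<^sub>R gq l t m)) (at t within {0..tf}) \<and>
        (\<forall>l. \<Theta> l t m - diff_op S l (\<lambda>k. entropy_vars G (v t k)) m =
             (1 / P1 S (m l)) *\<^sub>R g\<Theta> l t m) \<and>
        (\<forall>l. m l \<noteq> 0 \<and> m l \<noteq> npts S - 1 \<longrightarrow> gq l t m = 0 \<and> g\<Theta> l t m = 0) \<and>
        gq i t m = gI t m + viscous_penalty_q G i (Uwall t) (v t) (\<Theta> i t) m + gM t m + gS t m \<and>
        gM t m = 0 \<and>
        g\<Theta> i t m = viscous_penalty_theta G i (Uwall t) (v t) m)"

definition wall_quad :: "sbp \<Rightarrow> 3 \<Rightarrow> (node \<Rightarrow> real) \<Rightarrow> real" where
  "wall_quad S i h = (\<Sum>m \<in> wall_nodes S i. P_tan S i m * h m)"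

definition heat_flux_datum ::
  "fluid \<Rightarrow> sbp \<Rightarrow> 3 \<Rightarrow> real \<Rightarrow> (real \<Rightarrow> node \<Rightarrow> state) \<Rightarrow> (real \<Rightarrow> node \<Rightarrow> state) \<Rightarrow>
   (real \<Rightarrow> node \<Rightarrow> real) \<Rightarrow> bool" where
  "heat_flux_datum G S i tf v \<theta> g \<longleftrightarrow>
     (\<forall>t \<in> {0..tf}.
        (\<Sum>m \<in> nodes S. P_tan S i m *
           (entropy_vars G (v t m) \<bullet> B_minus i (\<lambda>m. viscous_flux G (v t m) (\<theta> t m)) m)) =
        wall_quad S i (g t))"

definition adiabatic :: "sbp \<Rightarrow> 3 \<Rightarrow> real \<Rightarrow> (real \<Rightarrow> node \<Rightarrow> real) \<Rightarrow> bool" where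
  "adiabatic S i tf g \<longleftrightarrow> (\<forall>t \<in> {0..tf}. \<forall>m \<in> wall_nodes S i. g t m = 0)"

definition L2_datum :: "sbp \<Rightarrow> 3 \<Rightarrow> real \<Rightarrow> (real \<Rightarrow> node \<Rightarrow> real) \<Rightarrow> bool" where
  "L2_datum S i tf g \<longleftrightarrow> (\<forall>m \<in> wall_nodes S i.
     (\<lambda>t. g t m) \<in> borel_measurable (lebesgue_on {0..tf}) \<and>
     integrable (lebesgue_on {0..tf}) (\<lambda>t. (g t m)\<^sup>2))"

definition entropy_conservative :: "real \<Rightarrow> (real \<Rightarrow> real) \<Rightarrow> bool" where
  "entropy_conservative tf C \<longleftrightarrow> (\<forall>t \<in> {0..tf}. C t = 0)"

text \<open>
  \<open>C\<close> equals the wall integral of the datum and is bounded by the datum's discrete L2 norm: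
  at each instant, and, for time integrals, by the L2 norm over the wall and \<open>{0..\<tau>}\<close>.
  The constants involve only the discrete wall area and the elapsed time, never the solution.
\<close>

definition entropy_stable ::
  "sbp \<Rightarrow> 3 \<Rightarrow> real \<Rightarrow> (real \<Rightarrow> node \<Rightarrow> real) \<Rightarrow> (real \<Rightarrow> real) \<Rightarrow> bool" where
  "entropy_stable S i tf g C \<longleftrightarrow>
     (\<forall>t \<in> {0..tf}. C t = wall_quad S i (g t)) \<and>
     (\<forall>t \<in> {0..tf}. \<bar>C t\<bar> \<le>
        sqrt (wall_quad S i (\<lambda>_. 1)) * sqrt (wall_quad S i (\<lambda>m. (g t m)\<^sup>2))) \<and>
     (\<forall>\<tau> \<in> {0..tf}. integrable (lebesgue_on {0..\<tau>}) C \<and>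
        (LINT t|lebesgue_on {0..\<tau>}. \<bar>C t\<bar>) \<le>
        sqrt (\<tau> * wall_quad S i (\<lambda>_. 1)) *
        sqrt (LINT t|lebesgue_on {0..\<tau>}. wall_quad S i (\<lambda>m. (g t m)\<^sup>2)))"

end

theory Submission
  imports Defs
begin

text \<open>
  With \<open>F\<close>, \<open>F\<^sub>b\<close> the viscous fluxes and \<open>w\<close>, \<open>w\<^sub>b\<close> the entropy variables of the nodal and the manufactured
  state, a wall node contributes
  \<open>w \<bullet> (F - F\<^sub>b) / 2 + F \<bullet> (w - w\<^sub>b) / 2 = w \<bullet> F - (w \<bullet> F\<^sub>b + F \<bullet> w\<^sub>b) / 2\<close>.
  The manufactured state is chosen so that the mixed term \<open>w \<bullet> F\<^sub>b + F \<bullet> w\<^sub>b\<close> vanishes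
  (\<open>wall_pairing_cancels\<close>). What remains is the discrete wall integral of \<open>w \<bullet> F\<close>, which is the
  quantity identified with the datum \<open>g\<close>. The contribution is therefore zero for \<open>g = 0\<close>, and in
  general it is bounded by the \<open>L\<^sup>2\<close> norms of \<open>g\<close> through the Cauchy-Schwarz inequality, applied
  once to the quadrature over the wall and once to the integral over time.

  The mixed term is computed in primitive variables. Both fluxes have the form
  \<open>\<nu> (dq/dw) (dw/dv) \<pi>\<close>, and \<open>(dq/dw) (dw/dv)\<close> is the explicit Jacobian \<open>dq/dv\<close>. The
  Jacobian \<open>dq/dw\<close> is the derivative of a composite with an inverse function, so this chain rule
  (\<open>dq_dw_dw_dv\<close>) needs that the entropy variables are injective on the open set of admissible
  states and that \<open>dw/dv\<close> is invertible there; an explicit inverse is given below.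
\<close>

section \<open>Jacobians of the entropy and conservative variables\<close>

text \<open>The matrix \<open>dw/dv\<close> at the state \<open>(\<rho>, U, T)\<close>, applied to a primitive increment.\<close>

definition entropy_jacobian :: "fluid \<Rightarrow> state \<Rightarrow> state \<Rightarrow> state" where
  "entropy_jacobian G = (\<lambda>(\<rho>, U, T) (a, b, c).
     (gas_R G * a / \<rho> - c_v G * c / T - (U \<bullet> b) / T + (U \<bullet> U) * c / (2 * T\<^sup>2),
      (1 / T) *\<^sub>R b - (c / T\<^sup>2) *\<^sub>R U,
      c / T\<^sup>2))"

text \<open>
  Back substitution in \<open>dw/dv\<close>, which is triangular if the unknowns are eliminated in the order
  temperature, velocity, density.
\<close>

definition entropy_jacobian_inverse :: "fluid \<Rightarrow> state \<Rightarrow> state \<Rightarrow> state" where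
  "entropy_jacobian_inverse G = (\<lambda>(\<rho>, U, T) (x, y, z).
     (\<rho> / gas_R G * (x + c_v G * T * z + U \<bullet> y + (U \<bullet> U) * z / 2),
      T *\<^sub>R y + (T * z) *\<^sub>R U,
      T\<^sup>2 * z))"

text \<open>The matrix \<open>dq/dv\<close> at the state \<open>(\<rho>, U, T)\<close>, applied to a primitive increment.\<close>

definition conservative_jacobian :: "fluid \<Rightarrow> state \<Rightarrow> state \<Rightarrow> state" where
  "conservative_jacobian G = (\<lambda>(\<rho>, U, T) (a, b, c).
     (a, a *\<^sub>R U + \<rho> *\<^sub>R b,
      a * total_energy G (\<rho>, U, T) + \<rho> * (c_v G * c + U \<bullet> b)))"

lemma gas_R_pos: "valid_fluid G \<Longrightarrow> gas_R G > 0"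
  by (simp add: valid_fluid_def gas_R_def)

lemma open_admissible: "open admissible"
proof -
  have "admissible = {x. 0 < fst x} \<inter> {x. 0 < snd (snd x)}"
    by (auto simp: admissible_def)
  moreover have "open ({x :: state. 0 < fst x} \<inter> {x. 0 < snd (snd x)})"
    by (intro open_Int open_Collect_less continuous_intros)
  ultimately show ?thesis
    by metis
qed

lemma entropy_vars_has_derivative:
  assumes "v \<in> admissible"
  shows "(entropy_vars G has_derivative entropy_jacobian G v) (at v)"
proof -
  obtain \<rho> U T where v: "v = (\<rho>, U, T)"
    by (cases v) auto
  have pos: "\<rho> > 0" "T > 0"
    using assms by (auto simp: v admissible_def)
  have ev: "entropy_vars G = (\<lambda>x.
      (c_p G - (c_v G * ln (snd (snd x)) - gas_R G * ln (fst x) + s_0 G)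
         - (fst (snd x) \<bullet> fst (snd x)) / (2 * snd (snd x)),
       (1 / snd (snd x)) *\<^sub>R fst (snd x), - 1 / snd (snd x)))"
    by (auto simp: fun_eq_iff entropy_vars_def thermo_entropy_def power2_norm_eq_inner)
  have ej: "entropy_jacobian G v = (\<lambda>h.
      (gas_R G * fst h / \<rho> - c_v G * snd (snd h) / T - (U \<bullet> fst (snd h)) / T
         + (U \<bullet> U) * snd (snd h) / (2 * T\<^sup>2),
       (1 / T) *\<^sub>R fst (snd h) - (snd (snd h) / T\<^sup>2) *\<^sub>R U,
       snd (snd h) / T\<^sup>2))"
    by (auto simp: fun_eq_iff entropy_jacobian_def v)
  show ?thesis
    unfolding ev ej unfolding v using pos
    by (auto intro!: derivative_eq_intros
        simp: fun_eq_iff field_simps power2_eq_square inner_commute)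
qed

lemma conservative_vars_has_derivative:
  "(conservative_vars G has_derivative conservative_jacobian G v) (at v)"
proof -
  obtain \<rho> U T where v: "v = (\<rho>, U, T)"
    by (cases v) auto
  have cv: "conservative_vars G = (\<lambda>x.
      (fst x, fst x *\<^sub>R fst (snd x),
       fst x * (c_v G * snd (snd x) + (fst (snd x) \<bullet> fst (snd x)) / 2)))"
    by (auto simp: fun_eq_iff conservative_vars_def total_energy_def power2_norm_eq_inner)
  have cj: "conservative_jacobian G v = (\<lambda>h.
      (fst h, fst h *\<^sub>R U + \<rho> *\<^sub>R fst (snd h),
       fst h * (c_v G * T + (U \<bullet> U) / 2) + \<rho> * (c_v G * snd (snd h) + U \<bullet> fst (snd h))))"
    by (auto simp: fun_eq_iff conservative_jacobian_def v total_energy_def power2_norm_eq_inner)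
  show ?thesis
    unfolding cv cj unfolding v
    by (auto intro!: derivative_eq_intros simp: fun_eq_iff field_simps inner_commute)
qed

text \<open>
  The last entropy variable determines the temperature, the middle ones then the velocity, and
  the first one the logarithm of the density, whose coefficient is the gas constant \<open>R > 0\<close>.
\<close>

lemma entropy_vars_inj_on:
  assumes "valid_fluid G"
  shows "inj_on (entropy_vars G) admissible"
proof (rule inj_onI)
  fix v v' assume "v \<in> admissible" "v' \<in> admissible" and eq: "entropy_vars G v = entropy_vars G v'"
  then obtain \<rho> U T \<rho>' U' T' where v: "v = (\<rho>, U, T)" "v' = (\<rho>', U', T')"
    and pos: "\<rho> > 0" "T > 0" "\<rho>' > 0" "T' > 0"
    by (auto simp: admissible_def)
  have T: "T = T'"
    using eq pos by (auto simp: v entropy_vars_def)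
  then have U: "U = U'"
    using eq pos by (auto simp: v entropy_vars_def)
  have "gas_R G * ln \<rho> = gas_R G * ln \<rho>'"
    using eq by (auto simp: v entropy_vars_def thermo_entropy_def T U)
  then have "\<rho> = \<rho>'"
    using pos gas_R_pos[OF assms] by simp
  then show "v = v'"
    by (simp add: v T U)
qed

lemma entropy_jacobian_right_inverse:
  assumes "valid_fluid G" "v \<in> admissible"
  shows "entropy_jacobian G v (entropy_jacobian_inverse G v \<theta>) = \<theta>"
proof -
  obtain \<rho> U T where v: "v = (\<rho>, U, T)" and pos: "\<rho> > 0" "T > 0"
    using assms(2) by (auto simp: admissible_def)
  show ?thesis
    using pos gas_R_pos[OF assms(1)]
    by (cases \<theta>)
      (simp add: v entropy_jacobian_def entropy_jacobian_inverse_def inner_add_right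
        field_simps power2_eq_square)
qed

lemma entropy_jacobian_left_inverse:
  assumes "valid_fluid G" "v \<in> admissible"
  shows "entropy_jacobian_inverse G v (entropy_jacobian G v \<pi>) = \<pi>"
proof -
  obtain \<rho> U T where v: "v = (\<rho>, U, T)" and pos: "\<rho> > 0" "T > 0"
    using assms(2) by (auto simp: admissible_def)
  show ?thesis
    using pos gas_R_pos[OF assms(1)]
    by (cases \<pi>)
      (simp add: v entropy_jacobian_def entropy_jacobian_inverse_def inner_diff_right
        field_simps power2_eq_square)
qed

lemma dw_dv_eq: "v \<in> admissible \<Longrightarrow> dw_dv G v = entropy_jacobian G v"
  unfolding dw_dv_def by (rule frechet_derivative_at[symmetric, OF entropy_vars_has_derivative])

text \<open>
  The primitive gradient is written with \<open>inv\<close>, which solves the equation only because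
  \<open>dw/dv\<close> is surjective.
\<close>

lemma dw_dv_primitive_gradient:
  assumes "valid_fluid G" "v \<in> admissible"
  shows "dw_dv G v (primitive_gradient G v \<theta>) = \<theta>"
proof -
  have "surj (entropy_jacobian G v)"
    by (rule surjI) (rule entropy_jacobian_right_inverse[OF assms])
  then show ?thesis
    by (simp add: primitive_gradient_def dw_dv_eq[OF assms(2)] surj_f_inv_f)
qed

text \<open>
  The chain rule \<open>(dq/dw) (dw/dv) = dq/dv\<close>. It rests on the inverse function theorem, with
  \<open>inv_into admissible\<close> as a left inverse of the entropy variables on an open set.
\<close>

lemma dq_dw_dw_dv:
  assumes "valid_fluid G" "v \<in> admissible"
  shows "dq_dw G v (dw_dv G v \<pi>) = conservative_jacobian G v \<pi>"
proof -
  let ?g = "inv_into admissible (entropy_vars G)"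
  have cont: "continuous_on admissible (entropy_vars G)"
    by (meson continuous_at_imp_continuous_on entropy_vars_has_derivative has_derivative_continuous)
  have "(?g has_derivative entropy_jacobian_inverse G v) (at (entropy_vars G v))"
  proof (rule has_derivative_inverse_strong[OF open_admissible assms(2) cont])
    show "?g (entropy_vars G x) = x" if "x \<in> admissible" for x
      using entropy_vars_inj_on[OF assms(1)] that by simp
    show "(entropy_vars G has_derivative entropy_jacobian G v) (at v)"
      by (rule entropy_vars_has_derivative[OF assms(2)])
    show "entropy_jacobian G v \<circ> entropy_jacobian_inverse G v = id"
      by (simp add: fun_eq_iff entropy_jacobian_right_inverse[OF assms] del: split_paired_All)
  qed
  moreover have "?g (entropy_vars G v) = v"
    using entropy_vars_inj_on[OF assms(1)] assms(2) by simp
  ultimately have "((\<lambda>w. conservative_vars G (?g w)) has_derivative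
      (\<lambda>h. conservative_jacobian G v (entropy_jacobian_inverse G v h))) (at (entropy_vars G v))"
    using has_derivative_compose[of ?g "entropy_jacobian_inverse G v" "entropy_vars G v" UNIV
        "conservative_vars G" "conservative_jacobian G v"] conservative_vars_has_derivative[of G v]
    by simp
  then have "dq_dw G v = (\<lambda>h. conservative_jacobian G v (entropy_jacobian_inverse G v h))"
    unfolding dq_dw_def by (rule frechet_derivative_at[symmetric])
  then show ?thesis
    by (simp add: dw_dv_eq[OF assms(2)] entropy_jacobian_left_inverse[OF assms])
qed

section \<open>Cancellation at a wall node\<close>

lemma wall_state_admissible: "v \<in> admissible \<Longrightarrow> wall_state Uwall v \<in> admissible"
  by (auto simp: admissible_def wall_state_def)

text \<open>
  Write \<open>\<pi> = (a, b, c)\<close>. The signs in \<open>mirror_gradient\<close> make the two \<open>c\<close> terms opposite. The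
  \<open>b\<close> terms are \<open>\<plusminus> \<rho> (U - U') \<bullet> b / T\<close>: each pairing couples the momentum part of \<open>w\<close> at
  one state with the kinetic energy part of \<open>dq/dv\<close> at the other. In the \<open>a\<close> terms the
  entropies are equal because density and temperature are, the products \<open>U \<bullet> U'\<close> cancel, and the
  kinetic energies in the total energies cancel against the \<open>- U \<bullet> U / (2 T)\<close> in \<open>w\<close>.
\<close>

lemma mirror_pairing_cancels:
  assumes "T > 0"
  shows "entropy_vars G (\<rho>, U, T) \<bullet> conservative_jacobian G (\<rho>, U', T) (mirror_gradient \<pi>)
       + entropy_vars G (\<rho>, U', T) \<bullet> conservative_jacobian G (\<rho>, U, T) \<pi> = 0"
proof -
  obtain a b c where \<pi>: "\<pi> = (a, b, c)"
    by (cases \<pi>) auto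
  show ?thesis
    using assms
    by (simp add: \<pi> entropy_vars_def conservative_jacobian_def mirror_gradient_def
        total_energy_def thermo_entropy_def power2_norm_eq_inner inner_simps
        inner_commute[of U' U] field_simps)
qed

lemma wall_pairing_cancels:
  assumes "valid_fluid G" "v \<in> admissible"
  shows "entropy_vars G v \<bullet> wall_flux G Uwall v \<theta>
       + viscous_flux G v \<theta> \<bullet> entropy_vars G (wall_state Uwall v) = 0"
proof -
  obtain \<rho> U T where v: "v = (\<rho>, U, T)" and pos: "T > 0"
    using assms(2) by (auto simp: admissible_def)
  define \<pi> where "\<pi> = primitive_gradient G v \<theta>"
  define vb where "vb = wall_state Uwall v"
  have vb: "vb = (\<rho>, - U + 2 *\<^sub>R Uwall, T)"
    by (simp add: vb_def v wall_state_def)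
  have F: "viscous_flux G v \<theta> = nu G v *\<^sub>R conservative_jacobian G v \<pi>"
    using dq_dw_dw_dv[OF assms, of \<pi>]
    by (simp add: viscous_flux_def \<pi>_def dw_dv_primitive_gradient[OF assms])
  have Fb: "wall_flux G Uwall v \<theta> = nu G v *\<^sub>R conservative_jacobian G vb (mirror_gradient \<pi>)"
    using dq_dw_dw_dv[OF assms(1) wall_state_admissible[OF assms(2)]]
    by (simp add: wall_flux_def vb_def \<pi>_def)
  have "entropy_vars G v \<bullet> conservative_jacobian G vb (mirror_gradient \<pi>)
      + entropy_vars G vb \<bullet> conservative_jacobian G v \<pi> = 0"
    unfolding v vb by (rule mirror_pairing_cancels[OF pos])
  then show ?thesis
    unfolding F Fb vb_def[symmetric] inner_scaleR_left inner_scaleR_right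
    by (simp add: inner_commute[of "conservative_jacobian G v \<pi>"] flip: distrib_left)
qed

text \<open>
  Each penalty has the factor \<open>1 / 2\<close>, so the two terms \<open>w \<bullet> F / 2\<close> add up to one full copy of
  the wall entropy flux, while the mixed terms cancel.
\<close>

lemma viscous_contribution_eq:
  assumes "valid_fluid G" and "\<And>m. m \<in> nodes S \<Longrightarrow> v m \<in> admissible"
  shows "viscous_contribution G S i Uwall v \<theta> =
    (\<Sum>m \<in> nodes S. P_tan S i m *
       (entropy_vars G (v m) \<bullet> B_minus i (\<lambda>m. viscous_flux G (v m) (\<theta> m)) m))"
  unfolding viscous_contribution_def sum.distrib[symmetric]
proof (rule sum.cong[OF refl])
  fix m assume "m \<in> nodes S"
  then have "entropy_vars G (v m) \<bullet> wall_flux G (Uwall m) (v m) (\<theta> m)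
      + viscous_flux G (v m) (\<theta> m) \<bullet> entropy_vars G (wall_state (Uwall m) (v m)) = 0"
    using wall_pairing_cancels assms by blast
  moreover have "w \<bullet> ((1 / 2) *\<^sub>R (F - Fb)) + F \<bullet> ((1 / 2) *\<^sub>R (w - wb)) = w \<bullet> F"
    if "w \<bullet> Fb + F \<bullet> wb = 0" for w F Fb wb :: state
    using that inner_commute[of F w] by (simp add: inner_diff_right diff_divide_distrib)
  ultimately have "entropy_vars G (v m) \<bullet> viscous_penalty_q G i Uwall v \<theta> m
      + viscous_flux G (v m) (\<theta> m) \<bullet> viscous_penalty_theta G i Uwall v m
      = entropy_vars G (v m) \<bullet> B_minus i (\<lambda>m. viscous_flux G (v m) (\<theta> m)) m"
    unfolding viscous_penalty_q_def viscous_penalty_theta_def B_minus_def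
    by (cases "m i = 0") (simp_all only: simp_thms if_True if_False scaleR_zero_right
        inner_zero_right add_0_left)
  then show "P_tan S i m * (entropy_vars G (v m) \<bullet> viscous_penalty_q G i Uwall v \<theta> m)
      + P_tan S i m * (viscous_flux G (v m) (\<theta> m) \<bullet> viscous_penalty_theta G i Uwall v m)
      = P_tan S i m * (entropy_vars G (v m) \<bullet> B_minus i (\<lambda>m. viscous_flux G (v m) (\<theta> m)) m)"
    by (simp only: flip: distrib_left)
qed

section \<open>Bounds by the heat flux datum\<close>

lemma P_tan_nonneg:
  assumes "lgl_sbp S" "m \<in> wall_nodes S i"
  shows "0 \<le> P_tan S i m"
  using assms by (auto simp: P_tan_def wall_nodes_def nodes_def lgl_sbp_def less_imp_le intro!: prod_nonneg)

text \<open>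
  The Cauchy-Schwarz inequality with weights \<open>P_tan\<close>, which are split as products of square
  roots between the constant 1 and the function \<open>h\<close>.
\<close>

lemma wall_quad_Cauchy_Schwarz:
  assumes "lgl_sbp S"
  shows "\<bar>wall_quad S i h\<bar> \<le> sqrt (wall_quad S i (\<lambda>_. 1)) * sqrt (wall_quad S i (\<lambda>m. (h m)\<^sup>2))"
proof -
  let ?P = "\<lambda>m. sqrt (P_tan S i m)"
  have "(wall_quad S i h)\<^sup>2 = (\<Sum>m\<in>wall_nodes S i. ?P m * (?P m * h m))\<^sup>2"
    by (simp add: wall_quad_def P_tan_nonneg[OF assms] flip: mult.assoc)
  also have "\<dots> \<le> (\<Sum>m\<in>wall_nodes S i. (?P m)\<^sup>2) * (\<Sum>m\<in>wall_nodes S i. (?P m * h m)\<^sup>2)"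
    by (rule Cauchy_Schwarz_ineq_sum)
  also have "\<dots> = wall_quad S i (\<lambda>_. 1) * wall_quad S i (\<lambda>m. (h m)\<^sup>2)"
    by (simp add: wall_quad_def P_tan_nonneg[OF assms] power_mult_distrib)
  finally have "sqrt ((wall_quad S i h)\<^sup>2)
      \<le> sqrt (wall_quad S i (\<lambda>_. 1) * wall_quad S i (\<lambda>m. (h m)\<^sup>2))"
    by (rule real_sqrt_le_mono)
  then show ?thesis
    by (simp only: real_sqrt_abs real_sqrt_mult)
qed

lemma wall_quad_square_nonneg: "lgl_sbp S \<Longrightarrow> 0 \<le> wall_quad S i (\<lambda>m. (h m)\<^sup>2)"
  by (auto simp: wall_quad_def P_tan_nonneg intro!: sum_nonneg)

text \<open>
  The Cauchy-Schwarz inequality against a constant: unless the measure is zero, the variance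
  of \<open>h\<close> about its mean \<open>k\<close> is nonnegative.
\<close>

lemma (in finite_measure) integral_power2_le:
  fixes h :: "'a \<Rightarrow> real"
  assumes "integrable M h" "integrable M (\<lambda>x. (h x)\<^sup>2)"
  shows "(LINT x|M. h x)\<^sup>2 \<le> measure M (space M) * (LINT x|M. (h x)\<^sup>2)"
proof (cases "measure M (space M) = 0")
  case True
  then have "AE x in M. h x = 0"
    by (intro AE_I[of _ _ "space M"]) (auto simp: emeasure_eq_measure)
  then show ?thesis
    using True by (simp add: integral_eq_zero_AE)
next
  case False
  define c where "c = measure M (space M)"
  define k where "k = (LINT x|M. h x) / c"
  have c: "c > 0"
    using False by (simp add: c_def zero_less_measure_iff)
  have "0 \<le> (LINT x|M. (h x - k)\<^sup>2)"
    by simp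
  also have "\<dots> = (LINT x|M. (h x)\<^sup>2 - 2 * k * h x + k\<^sup>2)"
    by (simp add: power2_diff algebra_simps)
  also have "\<dots> = (LINT x|M. (h x)\<^sup>2) - 2 * k * (LINT x|M. h x) + k\<^sup>2 * c"
    using assms by (simp add: c_def)
  also have "\<dots> = (LINT x|M. (h x)\<^sup>2) - (LINT x|M. h x)\<^sup>2 / c"
    using c by (simp add: k_def field_simps power2_eq_square)
  finally show ?thesis
    using c by (simp add: field_simps c_def[symmetric])
qed

lemma integrable_lebesgue_on_initial:
  fixes h :: "real \<Rightarrow> real"
  assumes "integrable (lebesgue_on {0..b}) h" "a \<le> b"
  shows "integrable (lebesgue_on {0..a}) h"
proof -
  have "integrable lebesgue (\<lambda>x. indicator {0..b} x *\<^sub>R h x)"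
    using assms(1) integrable_restrict_space[of "{0..b}" lebesgue h] by simp
  then have "integrable lebesgue (\<lambda>x. indicator {0..a} x *\<^sub>R (indicator {0..b} x *\<^sub>R h x))"
    by (rule integrable_mult_indicator[rotated]) simp
  also have "(\<lambda>x. indicator {0..a} x *\<^sub>R (indicator {0..b} x *\<^sub>R h x)) = (\<lambda>x. indicator {0..a} x *\<^sub>R h x)"
    using assms(2) by (auto simp: indicator_def)
  finally show ?thesis
    using integrable_restrict_space[of "{0..a}" lebesgue h] by simp
qed

text \<open>
  Square integrability of the datum at each wall node, over a bounded time interval, gives
  integrability of its wall integral. The bound combines the pointwise estimate in the wall
  quadrature with \<open>integral_power2_le\<close>; the interval has measure \<open>\<tau>\<close>, possibly zero.
\<close>

lemma wall_quad_time_bound: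
  assumes S: "lgl_sbp S" and g: "L2_datum S i tf g" and \<tau>: "\<tau> \<in> {0..tf}"
  shows "integrable (lebesgue_on {0..\<tau>}) (\<lambda>t. wall_quad S i (g t))" (is ?int)
    and "(LINT t|lebesgue_on {0..\<tau>}. \<bar>wall_quad S i (g t)\<bar>) \<le>
      sqrt (\<tau> * wall_quad S i (\<lambda>_. 1)) *
      sqrt (LINT t|lebesgue_on {0..\<tau>}. wall_quad S i (\<lambda>m. (g t m)\<^sup>2))" (is ?bound)
proof -
  interpret tf: finite_measure "lebesgue_on {0..tf}"
    by (rule finite_measure_lebesgue_on) auto
  interpret finite_measure "lebesgue_on {0..\<tau>}"
    by (rule finite_measure_lebesgue_on) auto
  let ?M = "lebesgue_on {0..\<tau>}"
  let ?C = "\<lambda>t. wall_quad S i (g t)"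
  let ?W = "\<lambda>t. wall_quad S i (\<lambda>m. (g t m)\<^sup>2)"
  let ?A = "wall_quad S i (\<lambda>_. 1)"
  have A: "0 \<le> ?A"
    using wall_quad_square_nonneg[OF S, of i "\<lambda>_. 1"] by simp
  have g_int: "integrable ?M (\<lambda>t. g t m)" "integrable ?M (\<lambda>t. (g t m)\<^sup>2)"
    if "m \<in> wall_nodes S i" for m
  proof -
    have meas: "(\<lambda>t. g t m) \<in> borel_measurable (lebesgue_on {0..tf})"
      and sq: "integrable (lebesgue_on {0..tf}) (\<lambda>t. (g t m)\<^sup>2)"
      using g that by (auto simp: L2_datum_def)
    have "\<tau> \<le> tf"
      using \<tau> by simp
    then show "integrable ?M (\<lambda>t. g t m)" "integrable ?M (\<lambda>t. (g t m)\<^sup>2)"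
      using tf.square_integrable_imp_integrable[OF meas sq] sq
      by (blast intro: integrable_lebesgue_on_initial)+
  qed
  show C: ?int
    unfolding wall_quad_def using g_int by auto
  have W: "integrable ?M ?W"
    unfolding wall_quad_def using g_int by auto
  have le: "(?C t)\<^sup>2 \<le> ?A * ?W t" for t
  proof -
    have "\<bar>?C t\<bar>\<^sup>2 \<le> (sqrt ?A * sqrt (?W t))\<^sup>2"
      by (rule power_mono[OF wall_quad_Cauchy_Schwarz[OF S] abs_ge_zero])
    then show ?thesis
      using A wall_quad_square_nonneg[OF S, of i "g t"] by (simp add: power_mult_distrib)
  qed
  have C2: "integrable ?M (\<lambda>t. (?C t)\<^sup>2)"
  proof (rule Bochner_Integration.integrable_bound)
    show "integrable ?M (\<lambda>t. ?A * ?W t)"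
      using W by simp
    show "AE t in ?M. norm ((?C t)\<^sup>2) \<le> norm (?A * ?W t)"
      using le by (intro AE_I2) (smt (verit) real_norm_def zero_le_power2)
  qed (use C in auto)
  have "(LINT t|?M. \<bar>?C t\<bar>)\<^sup>2 \<le> \<tau> * (LINT t|?M. (?C t)\<^sup>2)"
    using integral_power2_le[of "\<lambda>t. \<bar>?C t\<bar>"] C C2 \<tau>
    by (simp add: measure_restrict_space space_restrict_space)
  also have "\<dots> \<le> \<tau> * (LINT t|?M. ?A * ?W t)"
    using C2 W le \<tau> by (intro mult_left_mono integral_mono) auto
  also have "\<dots> = \<tau> * ?A * (LINT t|?M. ?W t)"
    by simp
  finally show ?bound
    by (simp add: real_le_rsqrt flip: real_sqrt_mult)
qed

theorem theorem5:
  fixes G :: fluid and S :: sbp and f :: "3 \<Rightarrow> state \<Rightarrow> state \<Rightarrow> state"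
    and i :: 3 and tf :: real
    and Uwall :: "real \<Rightarrow> node \<Rightarrow> real ^ 3" and v :: "real \<Rightarrow> node \<Rightarrow> state"
    and \<Theta> gq g\<Theta> :: "3 \<Rightarrow> real \<Rightarrow> node \<Rightarrow> state"
    and gI gM gS :: "real \<Rightarrow> node \<Rightarrow> state"
    and g :: "real \<Rightarrow> node \<Rightarrow> real"
  assumes "valid_fluid G" and "lgl_sbp S" and "entropy_conservative_flux G f" and "tf > 0"
    and no_penetration: "\<And>t m. t \<in> {0..tf} \<Longrightarrow> m \<in> wall_nodes S i \<Longrightarrow> Uwall t m $ i = 0"
    and "semidiscretization G S f i tf Uwall v \<Theta> gq g\<Theta> gI gM gS"
    and "heat_flux_datum G S i tf v (\<Theta> i) g"
  shows "(adiabatic S i tf g \<longrightarrow>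
            entropy_conservative tf
              (\<lambda>t. viscous_contribution G S i (Uwall t) (v t) (\<Theta> i t))) \<and>
         (\<not> adiabatic S i tf g \<and> L2_datum S i tf g \<longrightarrow>
            entropy_stable S i tf g
              (\<lambda>t. viscous_contribution G S i (Uwall t) (v t) (\<Theta> i t)))"
proof -
  let ?C = "\<lambda>t. viscous_contribution G S i (Uwall t) (v t) (\<Theta> i t)"
  \<comment> \<open>Only at times in \<open>{0..tf}\<close> is the solution constrained, so the integrands below are
      compared on the interval of integration only.\<close>
  have C: "?C t = wall_quad S i (g t)" if t: "t \<in> {0..tf}" for t
  proof -
    have "v t m \<in> admissible" if "m \<in> nodes S" for m
      using assms(6) t that unfolding semidiscretization_def by blast
    then show ?thesis
      using viscous_contribution_eq[OF assms(1)] assms(7) t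
      by (simp add: heat_flux_datum_def)
  qed
  show ?thesis
  proof (intro conjI impI)
    assume "adiabatic S i tf g"
    then show "entropy_conservative tf ?C"
      by (simp add: entropy_conservative_def C adiabatic_def wall_quad_def)
  next
    assume "\<not> adiabatic S i tf g \<and> L2_datum S i tf g"
    then have g: "L2_datum S i tf g" ..
    have "integrable (lebesgue_on {0..\<tau>}) ?C \<and>
        (LINT t|lebesgue_on {0..\<tau>}. \<bar>?C t\<bar>) \<le>
        sqrt (\<tau> * wall_quad S i (\<lambda>_. 1)) *
        sqrt (LINT t|lebesgue_on {0..\<tau>}. wall_quad S i (\<lambda>m. (g t m)\<^sup>2))"
      if \<tau>: "\<tau> \<in> {0..tf}" for \<tau>
    proof -
      have eq: "\<And>t. t \<in> space (lebesgue_on {0..\<tau>}) \<Longrightarrow> ?C t = wall_quad S i (g t)"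
        using \<tau> by (intro C) simp
      have "integrable (lebesgue_on {0..\<tau>}) ?C
          \<longleftrightarrow> integrable (lebesgue_on {0..\<tau>}) (\<lambda>t. wall_quad S i (g t))"
        by (rule Bochner_Integration.integrable_cong[OF refl]) (rule eq)
      then have int: "integrable (lebesgue_on {0..\<tau>}) ?C"
        using wall_quad_time_bound(1)[OF assms(2) g \<tau>] by (rule iffD2)
      have "(LINT t|lebesgue_on {0..\<tau>}. \<bar>?C t\<bar>)
          = (LINT t|lebesgue_on {0..\<tau>}. \<bar>wall_quad S i (g t)\<bar>)"
        by (rule Bochner_Integration.integral_cong[OF refl]) (simp only: eq)
      then show ?thesis
        using int wall_quad_time_bound(2)[OF assms(2) g \<tau>] by (simp only: simp_thms)
    qed
    then show "entropy_stable S i tf g ?C"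
      unfolding entropy_stable_def
      by (intro conjI ballI) (simp_all only: C wall_quad_Cauchy_Schwarz[OF assms(2)])
  qed
qed

end
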